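(* Let an edge iterated graph system satisfying the standing assumptions be given; in particular it is distance-positive. Let $\Psi$ be its resistance renormalisation map. Then there exist a unique $\rho(\Psi)>0$ and a vector $\mathbf v\in(0,\infty)^K$, unique up to scalar multiples, such that $$\Psi(\mathbf v)=\rho(\Psi)\mathbf v.$$
   Context: **EIGS.** Fix $K\ge1$ colours $[K]=\{1,\dots,K\}$. An edge iterated graph system (EIGS) consists of finite directed rule graphs $R_1,\dots,R_K$ whose edges are coloured with colours in $[K]$, each $R_i$ having two distinct planting vertices $\beta_i^+\ne\beta_i^-$, and an initial graph $\Xi^0$, which is a single directed coloured edge; $\Xi^{n+1}$ is obtained from $\Xi^n$ by simultaneously replacing every directed edge $(a,b)$ of colour $i$ by a fresh copy of $R_i$ with $a\equiv\beta_i^+$, $b\equiv\beta_i^-$. Paths, distances and resistances refer to underlying undirected graphs, which are assumed simple and connected. **Resistance map.** $\Psi:(0,\infty)^K\to(0,\infty)^K$: $[\Psi(\mathbf x)]_i$ is the effective resistance between $\beta_i^+$ and $\beta_i^-$ in the electrical network on $R_i$ in which each $j$-coloured edge has resistance $[\mathbf x]_j$. **Standing assumptions.** (1) Canonical: every edge of every $R_i$ lies on a simple path joining $\beta_i^+$ and $\beta_i^-$. (2) Distance-positive: for all $i,j\in[K]$, every simple path in $R_i$ joining $\beta_i^+$ and $\beta_i^-$ contains at least one $j$-coloured edge; if $K=1$, additionally $d_{R_1}(\beta_1^+,\beta_1^-)\ge2$. (3) The $2K\times2K$ matrix $\mathbf N$ with rows $\kappa_{R_1}(\beta_1^+),\kappa_{R_1}(\beta_1^-),\dots,\kappa_{R_K}(\beta_K^+),\kappa_{R_K}(\beta_K^-)$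 is primitive, where $[\kappa_G(v)]_{2j-1}$ (resp. $[\kappa_G(v)]_{2j}$) is the number of $j$-coloured edges of $G$ leaving (resp. entering) $v$. (4) $\Xi^0$ is a single edge. *)

theory Defs
  imports
    "HOL-Analysis.Analysis"
    "Graph_Theory.Digraph_Component"
    "Graph_Theory.Vertex_Walk"
    "Graph_Theory.Shortest_Path"
begin

section \<open>Directed graphs and their underlying undirected graphs\<close>

text \<open>
  Loops are excluded, and so are parallel and antiparallel arcs: two distinct arcs never
  have the same unordered pair of endpoints.
\<close>

definition underlying_simple :: "('v, 'e) pre_digraph \<Rightarrow> bool" where
  "underlying_simple G \<longleftrightarrow>
     loopfree_digraph G \<and> inj_on (\<lambda>e. {tail G e, head G e}) (arcs G)"

definition rule_graph :: "('v, 'e) pre_digraph \<Rightarrow> bool" where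
  "rule_graph G \<longleftrightarrow> fin_digraph G \<and> underlying_simple G \<and> Digraph_Component.connected G"

text \<open>
  Simple paths of the underlying undirected graph are lists of distinct vertices; since that
  graph is simple, such a list determines the edges it traverses.
\<close>

definition simple_upath :: "('v, 'e) pre_digraph \<Rightarrow> 'v \<Rightarrow> 'v list \<Rightarrow> 'v \<Rightarrow> bool" where
  "simple_upath G a p b \<longleftrightarrow>
     vpath p (with_proj (mk_symmetric G)) \<and> hd p = a \<and> last p = b"

definition lies_on :: "('v, 'e) pre_digraph \<Rightarrow> 'e \<Rightarrow> 'v list \<Rightarrow> bool" where
  "lies_on G e p \<longleftrightarrow>
     (tail G e, head G e) \<in> set (vwalk_arcs p) \<or> (head G e, tail G e) \<in> set (vwalk_arcs p)"

definition udist :: "('v, 'e) pre_digraph \<Rightarrow> 'v \<Rightarrow> 'v \<Rightarrow> ereal" where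
  "udist G a b = wf_digraph.\<mu> (with_proj (mk_symmetric G)) (\<lambda>_. 1) a b"


section \<open>Effective resistance\<close>

text \<open>
  By Ohm's law the potential \<open>\<phi>\<close> drives the current below through the arc \<open>e\<close>, counted from tail
  to head; reversing an arc negates it, so the net currents do not depend on the orientation.
\<close>

definition current :: "('v, 'e) pre_digraph \<Rightarrow> ('e \<Rightarrow> real) \<Rightarrow> ('v \<Rightarrow> real) \<Rightarrow> 'e \<Rightarrow> real" where
  "current G r \<phi> e = (\<phi> (tail G e) - \<phi> (head G e)) / r e"

definition net_outflow :: "('v, 'e) pre_digraph \<Rightarrow> ('e \<Rightarrow> real) \<Rightarrow> 'v \<Rightarrow> real" where
  "net_outflow G f v = (\<Sum>e\<in>out_arcs G v. f e) - (\<Sum>e\<in>in_arcs G v. f e)"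

text \<open>Kirchhoff's current law for a unit current entering the network at \<open>a\<close> and leaving it at \<open>b\<close>.\<close>

definition unit_current_potential ::
    "('v, 'e) pre_digraph \<Rightarrow> ('e \<Rightarrow> real) \<Rightarrow> 'v \<Rightarrow> 'v \<Rightarrow> ('v \<Rightarrow> real) \<Rightarrow> bool" where
  "unit_current_potential G r a b \<phi> \<longleftrightarrow>
     (\<forall>v\<in>verts G. net_outflow G (current G r \<phi>) v =
        (if v = a then 1 else 0) - (if v = b then 1 else 0))"

text \<open>
  The potential exists and its drop is unique when \<open>G\<close> is finite and connected and all
  resistances are positive.
\<close>

definition eff_resistance ::
    "('v, 'e) pre_digraph \<Rightarrow> ('e \<Rightarrow> real) \<Rightarrow> 'v \<Rightarrow> 'v \<Rightarrow> real" where
  "eff_resistance G r a b =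
     (THE R. \<exists>\<phi>. unit_current_potential G r a b \<phi> \<and> R = \<phi> a - \<phi> b)"


section \<open>Edge iterated graph systems\<close>

text \<open>
  The colours are the elements of a finite type \<open>'k\<close>, so \<open>K\<close> is \<open>CARD('k)\<close>.
  The graph \<open>rule S i\<close> is \<open>R\<^sub>i\<close>, its planting vertices are \<open>plant S i True\<close> (that is,
  \<open>\<beta>\<^sub>i\<^sup>+\<close>) and \<open>plant S i False\<close> (that is, \<open>\<beta>\<^sub>i\<^sup>-\<close>), and \<open>init S\<close> is \<open>\<Xi>\<^sup>0\<close>.
\<close>

record ('v, 'e, 'k) eigs =
  rule :: "'k \<Rightarrow> ('v, 'e) pre_digraph"
  rule_colour :: "'k \<Rightarrow> 'e \<Rightarrow> 'k"
  plant :: "'k \<Rightarrow> bool \<Rightarrow> 'v"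
  init :: "('v, 'e) pre_digraph"
  init_colour :: "'e \<Rightarrow> 'k"

definition is_eigs :: "('v, 'e, 'k::finite) eigs \<Rightarrow> bool" where
  "is_eigs S \<longleftrightarrow>
     (\<forall>i. rule_graph (rule S i) \<and> (\<forall>s. plant S i s \<in> verts (rule S i)) \<and>
          plant S i True \<noteq> plant S i False) \<and>
     rule_graph (init S)"

definition canonical :: "('v, 'e, 'k::finite) eigs \<Rightarrow> bool" where
  "canonical S \<longleftrightarrow>
     (\<forall>i. \<forall>e\<in>arcs (rule S i).
        \<exists>p. simple_upath (rule S i) (plant S i True) p (plant S i False) \<and>
            lies_on (rule S i) e p)"

definition distance_positive :: "('v, 'e, 'k::finite) eigs \<Rightarrow> bool" where
  "distance_positive S \<longleftrightarrow>
     (\<forall>i j p. simple_upath (rule S i) (plant S i True) p (plant S i False) \<longrightarrow>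
        (\<exists>e\<in>arcs (rule S i). rule_colour S i e = j \<and> lies_on (rule S i) e p)) \<and>
     (CARD('k) = 1 \<longrightarrow>
        (\<forall>i. udist (rule S i) (plant S i True) (plant S i False) \<ge> 2))"

text \<open>
  The row \<open>(i, s)\<close> is \<open>\<kappa>\<close> of the planting vertex \<open>plant S i s\<close> in \<open>R\<^sub>i\<close>; the column \<open>(j, True)\<close>
  counts leaving and the column \<open>(j, False)\<close> entering edges of colour \<open>j\<close>. So \<open>True\<close> marks the
  odd and \<open>False\<close> the even positions of the usual \<open>2K \<times> 2K\<close> numbering.
\<close>

definition degree_matrix ::
    "('v, 'e, 'k::finite) eigs \<Rightarrow> nat ^ ('k \<times> bool) ^ ('k \<times> bool)" where
  "degree_matrix S = (\<chi> row col. case row of (i, s) \<Rightarrow> case col of (j, leaving) \<Rightarrow>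
     card {e \<in> (if leaving then out_arcs else in_arcs) (rule S i) (plant S i s).
             rule_colour S i e = j})"

definition primitive_matrix :: "nat ^ 'n ^ 'n::finite \<Rightarrow> bool" where
  "primitive_matrix A \<longleftrightarrow> (\<exists>m>0. \<forall>i j. 0 < (((**) A ^^ m) (mat 1)) $ i $ j)"

definition single_edge :: "('v, 'e) pre_digraph \<Rightarrow> bool" where
  "single_edge G \<longleftrightarrow>
     (\<exists>e. arcs G = {e} \<and> verts G = {tail G e, head G e} \<and> tail G e \<noteq> head G e)"

definition standing_assumptions :: "('v, 'e, 'k::finite) eigs \<Rightarrow> bool" where
  "standing_assumptions S \<longleftrightarrow>
     canonical S \<and> distance_positive S \<and> primitive_matrix (degree_matrix S) \<and>
     single_edge (init S)"

text \<open>Only the values at vectors with positive entries are meaningful.\<close>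

definition resistance_map :: "('v, 'e, 'k::finite) eigs \<Rightarrow> real ^ 'k \<Rightarrow> real ^ 'k" where
  "resistance_map S x =
     (\<chi> i. eff_resistance (rule S i) (\<lambda>e. x $ rule_colour S i e)
             (plant S i True) (plant S i False))"

end

theory Submission
  imports Defs
begin

text \<open>
  The resistance map is homogeneous of degree one.  By Dirichlet's principle,
  \<open>R \<ge> (\<psi> a - \<psi> b)\<^sup>2 / E(\<psi>)\<close> for every function \<open>\<psi>\<close> of energy \<open>E(\<psi>)\<close>, with equality at the
  unit current potential.  Distance-positivity says that the edges of any one colour \<open>j\<close> contain a
  cut between the planting vertices.  The indicator of this cut bounds the resistance from below by
  a multiple of \<open>x\<^sub>j\<close>; and since the unit current must cross the cut, increasing \<open>x\<^sub>j\<close> strictly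
  increases every resistance.  The lower bound makes the normalised map send a compact convex part
  of the open simplex to itself, so Brouwer's theorem yields an eigenvector; strict monotonicity
  makes it unique, by comparing two eigenvectors at the index that minimises their ratio.
\<close>

section \<open>Strictly monotone homogeneous maps on the positive cone\<close>

text \<open>By \<open>lower_bound\<close> the largest entry of \<open>x\<close> is at most
  \<open>C\<close> times the smallest entry of \<open>f x\<close>, which keeps normalised images
  away from the boundary of the cone. By \<open>strict\<close> every entry of the image grows as
  soon as one argument entry does.\<close>

locale strict_homogeneous_map =
  fixes f :: "real ^ 'k::finite \<Rightarrow> real ^ 'k" and C :: real
  assumes homogeneous: "\<lbrakk>c > 0; \<forall>i. x $ i > 0\<rbrakk> \<Longrightarrow> f (c *\<^sub>R x) = c *\<^sub>R f x"
    and strict: "\<lbrakk>\<forall>i. x $ i > 0; \<forall>i. x $ i \<le> y $ i; x \<noteq> y\<rbrakk> \<Longrightarrow> f x $ i < f y $ i"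
    and lower_bound: "\<forall>i. x $ i > 0 \<Longrightarrow> x $ j \<le> C * f x $ i"
    and C_pos: "C > 0"
begin

lemma mono: "\<lbrakk>\<forall>i. x $ i > 0; \<forall>i. x $ i \<le> y $ i\<rbrakk> \<Longrightarrow> f x $ i \<le> f y $ i"
  using strict[of x y i] by (cases "x = y") auto

lemma positive:
  assumes "\<forall>i. x $ i > 0"
  shows "f x $ i > 0"
proof -
  have "0 < C * f x $ i"
    using lower_bound[OF assms, of i i] assms by (metis order_less_le_trans)
  then show ?thesis
    using C_pos by (simp add: zero_less_mult_iff)
qed

text \<open>Continuity comes from order and homogeneity: near \<open>x\<close> each \<open>y\<close>
  lies between \<open>(1 - \<eta>) *\<^sub>R x\<close> and \<open>(1 + \<eta>) *\<^sub>R x\<close>,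
  which squeezes \<open>f y\<close>.\<close>

lemma tendsto_component:
  assumes x: "\<forall>i. x $ i > 0"
  shows "((\<lambda>y. f y $ i) \<longlongrightarrow> f x $ i) (at x within S)"
proof (rule tendstoI)
  fix e :: real assume e: "e > 0"
  \<comment> \<open>The bound 1/2 keeps \<open>1 - \<eta>\<close> positive; the other one leaves an
    error of at most \<open>e / 2\<close>.\<close>
  define \<eta> where "\<eta> = min (1/2) (e / (2 * f x $ i))"
  have fx: "f x $ i > 0" using positive[OF x] .
  have \<eta>: "\<eta> > 0" "\<eta> < 1" "\<eta> * f x $ i < e"
  proof -
    show "\<eta> > 0" "\<eta> < 1" using e fx by (auto simp: \<eta>_def)
    have "\<eta> * f x $ i \<le> e / (2 * f x $ i) * f x $ i"
      using fx by (intro mult_right_mono) (auto simp: \<eta>_def)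
    also have "\<dots> < e" using fx e by simp
    finally show "\<eta> * f x $ i < e" .
  qed
  have "\<forall>\<^sub>F y in at x within S. dist (y $ j) (x $ j) < \<eta> * x $ j" for j
    using \<eta>(1) x by (intro tendstoD[OF tendsto_vec_nth[OF tendsto_ident_at]]) simp
  then have "\<forall>\<^sub>F y in at x within S. \<forall>j. dist (y $ j) (x $ j) < \<eta> * x $ j"
    by (rule eventually_all_finite)
  then show "\<forall>\<^sub>F y in at x within S. dist (f y $ i) (f x $ i) < e"
  proof eventually_elim
    case (elim y)
    have lo: "(1 - \<eta>) * x $ j \<le> y $ j" and hi: "y $ j \<le> (1 + \<eta>) * x $ j" for j
      using elim[rule_format, of j] by (simp_all add: dist_real_def algebra_simps abs_less_iff)
    have y: "\<forall>j. y $ j > 0"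
      using lo x \<eta>(2) by (metis diff_gt_0_iff_gt mult_pos_pos order_less_le_trans)
    have "f ((1 - \<eta>) *\<^sub>R x) $ i \<le> f y $ i"
      using lo x \<eta>(2) by (intro mono) auto
    moreover have "f y $ i \<le> f ((1 + \<eta>) *\<^sub>R x) $ i"
      using hi y by (intro mono) auto
    ultimately have "(1 - \<eta>) * f x $ i \<le> f y $ i" "f y $ i \<le> (1 + \<eta>) * f x $ i"
      using homogeneous[of "1 - \<eta>" x] homogeneous[of "1 + \<eta>" x] x \<eta> by simp_all
    then show ?case
      using \<eta>(3) by (simp add: dist_real_def algebra_simps abs_less_iff)
  qed
qed

text \<open>Dividing \<open>f\<close> by its coordinate sum \<open>s\<close> gives a continuous
  self-map of the simplex truncated at \<open>\<delta>\<close>. At a Brouwer fixed point,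
  \<open>s\<close> is the eigenvalue.\<close>

lemma eigenvector_exists: "\<exists>\<rho> v. \<rho> > 0 \<and> (\<forall>i. v $ i > 0) \<and> f v = \<rho> *\<^sub>R v"
proof -
  define K where "K = real CARD('k)"
  have K: "K > 0" by (simp add: K_def)
  define M where "M = Max (range (\<lambda>i. f 1 $ i))"
  have M: "f 1 $ i \<le> M" for i unfolding M_def by (rule Max_ge) auto
  have CM: "C * M \<ge> 1"
  proof -
    fix i :: 'k
    have "1 \<le> C * f 1 $ i" using lower_bound[of 1 i i] by simp
    also have "\<dots> \<le> C * M" using M C_pos by simp
    finally show ?thesis .
  qed
  have M_pos: "M > 0"
    by (rule zero_less_mult_pos[OF _ C_pos]) (use CM in linarith)
  \<comment> \<open>With \<open>m\<close> the largest entry of \<open>x\<close>, all entries of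
    \<open>f x\<close> are at least \<open>m / C\<close> and their sum is at most
    \<open>K * m * M\<close>; this is the resulting ratio.\<close>
  define \<delta> where "\<delta> = 1 / (K * (C * M))"
  have \<delta>: "\<delta> > 0" using K C_pos M_pos by (simp add: \<delta>_def)
  define D where "D = {x :: real ^ 'k. sum (($) x) UNIV = 1 \<and> (\<forall>i. \<delta> \<le> x $ i)}"
  have D_pos: "\<forall>i. x $ i > 0" if "x \<in> D" for x
    using that \<delta> by (auto simp: D_def intro: less_le_trans)
  define s where "s x = sum (($) (f x)) UNIV" for x
  have s_pos: "s x > 0" if "\<forall>i. x $ i > 0" for x
    unfolding s_def using positive[OF that] by (intro sum_pos) auto
  have "\<exists>x\<in>D. (1 / s x) *\<^sub>R f x = x"
  proof -
    have "compact D"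
    proof (rule compact_eq_bounded_closed[THEN iffD2], rule conjI)
      have "D \<subseteq> cbox 0 1"
      proof
        fix x assume x: "x \<in> D"
        have "x $ i \<le> sum (($) x) UNIV" for i
          using D_pos[OF x] by (intro member_le_sum) (auto intro: less_imp_le)
        then show "x \<in> cbox 0 1"
          using x D_pos[OF x] by (auto simp: D_def mem_box_cart intro: less_imp_le)
      qed
      then show "bounded D" using bounded_cbox bounded_subset by blast
      show "closed D"
        unfolding D_def
        by (intro closed_Collect_conj closed_Collect_all closed_Collect_eq closed_Collect_le
            continuous_intros)
    qed
    moreover have "convex D"
    proof (rule convexI)
      fix x y :: "real ^ 'k" and u v :: real
      assume *: "x \<in> D" "y \<in> D" "0 \<le> u" "0 \<le> v" "u + v = 1"
      have "u * \<delta> + v * \<delta> \<le> u * x $ i + v * y $ i" for i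
        using * by (intro add_mono mult_left_mono) (auto simp: D_def)
      then have "\<delta> \<le> u * x $ i + v * y $ i" for i
        using *(5) by (simp flip: distrib_right)
      moreover have "(\<Sum>i\<in>UNIV. u * x $ i + v * y $ i) = 1"
        using * by (simp add: D_def sum.distrib flip: sum_distrib_left)
      ultimately show "u *\<^sub>R x + v *\<^sub>R y \<in> D"
        by (simp add: D_def)
    qed
    moreover have "D \<noteq> {}"
    proof -
      \<comment> \<open>Since \<open>C * M \<ge> 1\<close>, the barycentre of the simplex survives
        the truncation.\<close>
      have "\<delta> \<le> 1 / K"
        unfolding \<delta>_def using K CM by (intro divide_left_mono) (auto simp: mult_pos_pos)
      then have "(\<chi> i. 1 / K) \<in> D"
        using K by (simp add: D_def K_def)
      then show ?thesis by auto
    qed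
    moreover have "continuous_on D (\<lambda>x. (1 / s x) *\<^sub>R f x)"
    proof -
      have fi: "continuous_on D (\<lambda>x. f x $ i)" for i
        unfolding continuous_on using tendsto_component[OF D_pos] by blast
      have "continuous_on D f"
        using continuous_on_vec_lambda[of D "\<lambda>i x. f x $ i"] fi by simp
      moreover have "continuous_on D s"
        unfolding s_def by (intro continuous_on_sum fi)
      moreover have "\<forall>x\<in>D. s x \<noteq> 0"
        using s_pos D_pos by force
      ultimately show ?thesis by (intro continuous_intros) auto
    qed
    moreover have "(\<lambda>x. (1 / s x) *\<^sub>R f x) \<in> D \<rightarrow> D"
    proof
      fix x assume "x \<in> D"
      then have x: "\<forall>i. x $ i > 0" by (rule D_pos)
      define m where "m = Max (range (($) x))"
      have xm: "x $ i \<le> m" for i unfolding m_def by (rule Max_ge) auto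
      have m: "m > 0" using x xm by (metis less_le_trans)
      have "m \<in> range (($) x)" unfolding m_def by (rule Max_in) auto
      then have m_attained: "\<exists>j. m = x $ j" by blast
      have lo: "m \<le> C * f x $ i" for i
        using lower_bound[OF x] m_attained by auto
      have hi: "f x $ i \<le> m * M" for i
      proof -
        have "f x $ i \<le> f (m *\<^sub>R 1) $ i" using x xm by (intro mono) auto
        also have "\<dots> = m * f 1 $ i" using homogeneous[of m 1] m by simp
        also have "\<dots> \<le> m * M" using M m by simp
        finally show ?thesis .
      qed
      have "s x \<le> (\<Sum>i\<in>(UNIV::'k set). m * M)"
        unfolding s_def by (intro sum_mono hi)
      also have "\<dots> = K * m * M" by (simp add: K_def)
      finally have s: "s x \<le> K * m * M" .
      have "\<delta> \<le> f x $ i / s x" for i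
      proof -
        have "\<delta> * s x \<le> \<delta> * (K * m * M)" using s \<delta> by simp
        also have "\<dots> = m / C" using K M_pos C_pos by (simp add: \<delta>_def)
        also have "\<dots> \<le> f x $ i" using lo[of i] C_pos by (simp add: field_simps)
        finally show ?thesis using s_pos[OF x] by (simp add: pos_le_divide_eq)
      qed
      moreover have "(\<Sum>i\<in>UNIV. f x $ i / s x) = 1"
        using s_pos[OF x] by (simp add: s_def flip: sum_divide_distrib)
      ultimately show "(1 / s x) *\<^sub>R f x \<in> D" by (simp add: D_def)
    qed
    ultimately obtain x where "x \<in> D" "(1 / s x) *\<^sub>R f x = x"
      by (rule brouwer)
    then show ?thesis by blast
  qed
  then obtain x where x: "x \<in> D" "(1 / s x) *\<^sub>R f x = x" by blast
  have "f x = s x *\<^sub>R ((1 / s x) *\<^sub>R f x)" using s_pos[OF D_pos[OF x(1)]] by simp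
  then have "f x = s x *\<^sub>R x" using x(2) by simp
  then show ?thesis using s_pos D_pos x(1) by blast
qed

text \<open>Let \<open>t\<close> be the largest scalar with \<open>t *\<^sub>R v \<le> w\<close>
  entrywise. At an index \<open>k\<close> of contact, monotonicity compares
  \<open>\<rho> * w $ k\<close> with \<open>\<rho>' * w $ k\<close>. If the eigenvalues agree,
  \<open>strict\<close> forbids contact unless the vectors coincide.\<close>

lemma eigenvalue_le:
  assumes v: "\<forall>i. v $ i > 0" "f v = \<rho> *\<^sub>R v"
    and w: "\<forall>i. w $ i > 0" "f w = \<rho>' *\<^sub>R w"
  obtains t where "t > 0" "\<rho> \<le> \<rho>'" "\<rho> = \<rho>' \<Longrightarrow> w = t *\<^sub>R v"
proof -
  define t where "t = Min (range (\<lambda>i. w $ i / v $ i))"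
  have "t \<in> range (\<lambda>i. w $ i / v $ i)" unfolding t_def by (rule Min_in) auto
  then obtain k where k: "t = w $ k / v $ k" by blast
  have t: "t > 0" using k v w by simp
  have "t \<le> w $ i / v $ i" for i unfolding t_def by (rule Min_le) auto
  then have le: "t * v $ i \<le> w $ i" for i
    using v(1) by (simp add: pos_le_divide_eq)
  have tk: "t * v $ k = w $ k" using k v(1) by (simp add: less_imp_neq[THEN not_sym])
  have ftv: "f (t *\<^sub>R v) $ k = \<rho> * w $ k"
    using homogeneous[OF t v(1)] v(2) tk by (simp add: algebra_simps)
  have "f (t *\<^sub>R v) $ k \<le> f w $ k"
    using v t le by (intro mono) auto
  then have "\<rho> * w $ k \<le> \<rho>' * w $ k" using ftv w(2) by simp
  then have "\<rho> \<le> \<rho>'" using w(1) by (meson mult_le_cancel_right_pos)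
  moreover have "w = t *\<^sub>R v" if "\<rho> = \<rho>'"
  proof (rule ccontr)
    assume "w \<noteq> t *\<^sub>R v"
    then have "f (t *\<^sub>R v) $ k < f w $ k"
      using v t le by (intro strict) auto
    then show False using ftv w(2) that by simp
  qed
  ultimately show ?thesis using that t by blast
qed

lemma eigenvector_unique:
  assumes "\<forall>i. v $ i > 0" "f v = \<rho> *\<^sub>R v" "\<forall>i. w $ i > 0" "f w = \<rho>' *\<^sub>R w"
  shows "\<rho>' = \<rho> \<and> (\<exists>c>0. w = c *\<^sub>R v)"
proof -
  obtain t where t: "t > 0" "\<rho> \<le> \<rho>'" "\<rho> = \<rho>' \<Longrightarrow> w = t *\<^sub>R v"
    using eigenvalue_le[OF assms] by blast
  have "\<rho>' \<le> \<rho>" using eigenvalue_le[OF assms(3,4,1,2)] by blast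
  then have "\<rho>' = \<rho>" using t(2) by simp
  then show ?thesis using t by auto
qed

end


section \<open>Dirichlet's principle\<close>

text \<open>The energy form in polarised shape, because the potential is characterised by its
  pairing with all test functions; the diagonal is the energy.\<close>

definition dirichlet ::
    "('v, 'e) pre_digraph \<Rightarrow> ('e \<Rightarrow> real) \<Rightarrow> ('v \<Rightarrow> real) \<Rightarrow> ('v \<Rightarrow> real) \<Rightarrow> real" where
  "dirichlet G r \<phi> \<psi> =
     (\<Sum>e\<in>arcs G. (\<phi> (tail G e) - \<phi> (head G e)) * (\<psi> (tail G e) - \<psi> (head G e)) / r e)"

lemma dirichlet_commute: "dirichlet G r \<phi> \<psi> = dirichlet G r \<psi> \<phi>"
  by (simp add: dirichlet_def mult.commute)

lemma dirichlet_add_scaled: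
  "dirichlet G r (\<lambda>v. \<phi> v + t * \<psi> v) (\<lambda>v. \<phi> v + t * \<psi> v) =
     dirichlet G r \<phi> \<phi> + 2 * t * dirichlet G r \<phi> \<psi> + t\<^sup>2 * dirichlet G r \<psi> \<psi>"
proof -
  have *: "((x + t * y) - (x' + t * y')) * ((x + t * y) - (x' + t * y')) / s =
      (x - x') * (x - x') / s + 2 * t * ((x - x') * (y - y') / s) + t\<^sup>2 * ((y - y') * (y - y') / s)"
    for x x' y y' s :: real
    by (simp add: add_divide_distrib diff_divide_distrib algebra_simps power2_eq_square)
  show ?thesis
    by (simp add: dirichlet_def * sum.distrib sum_distrib_left)
qed

lemma dirichlet_nonneg: "\<forall>e\<in>arcs G. 0 < r e \<Longrightarrow> 0 \<le> dirichlet G r \<phi> \<phi>"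
  unfolding dirichlet_def by (intro sum_nonneg) (auto intro: less_imp_le)

text \<open>First variation without derivatives: try \<open>t = - p / q\<close>, where the quadratic
  is smallest, or \<open>t = - p\<close> if \<open>q\<close> vanishes. It serves both the
  stationarity of a minimiser and the null vectors of the energy form.\<close>

lemma linear_coefficient_eq_0:
  fixes p q :: real
  assumes "\<And>t. 0 \<le> 2 * t * p + t\<^sup>2 * q" "0 \<le> q"
  shows "p = 0"
proof (cases "q = 0")
  case True
  then show ?thesis using assms(1)[of "- p"] by (auto simp: mult_le_0_iff)
next
  case False
  have "0 \<le> 2 * (- p / q) * p + (- p / q)\<^sup>2 * q" by (rule assms(1))
  also have "\<dots> = - (p\<^sup>2 / q)"
    using False by (simp add: power2_eq_square field_simps)
  finally have "p\<^sup>2 / q \<le> 0" by simp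
  then show ?thesis using False assms(2) by (simp add: divide_le_0_iff)
qed

section \<open>Energy identities on a finite network\<close>

context fin_digraph
begin

text \<open>Summation by parts: each arc enters once at its tail and once, with the opposite sign,
  at its head.\<close>

lemma sum_mult_net_outflow:
  "(\<Sum>v\<in>verts G. \<psi> v * net_outflow G f v) =
     (\<Sum>e\<in>arcs G. (\<psi> (tail G e) - \<psi> (head G e)) * f e)"
proof -
  have "(\<Sum>v\<in>verts G. \<psi> v * (\<Sum>e\<in>out_arcs G v. f e)) =
      (\<Sum>v\<in>verts G. \<Sum>e | e \<in> arcs G \<and> tail G e = v. \<psi> (tail G e) * f e)"
    by (auto simp: sum_distrib_left out_arcs_def intro!: sum.cong)
  also have "\<dots> = (\<Sum>e\<in>arcs G. \<psi> (tail G e) * f e)"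
    by (rule sum.group) auto
  finally have tails: "(\<Sum>v\<in>verts G. \<psi> v * (\<Sum>e\<in>out_arcs G v. f e)) =
      (\<Sum>e\<in>arcs G. \<psi> (tail G e) * f e)" .
  have "(\<Sum>v\<in>verts G. \<psi> v * (\<Sum>e\<in>in_arcs G v. f e)) =
      (\<Sum>v\<in>verts G. \<Sum>e | e \<in> arcs G \<and> head G e = v. \<psi> (head G e) * f e)"
    by (auto simp: sum_distrib_left in_arcs_def intro!: sum.cong)
  also have "\<dots> = (\<Sum>e\<in>arcs G. \<psi> (head G e) * f e)"
    by (rule sum.group) auto
  finally have heads: "(\<Sum>v\<in>verts G. \<psi> v * (\<Sum>e\<in>in_arcs G v. f e)) =
      (\<Sum>e\<in>arcs G. \<psi> (head G e) * f e)" .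
  show ?thesis
    by (simp add: net_outflow_def right_diff_distrib left_diff_distrib sum_subtractf tails heads)
qed

lemma dirichlet_eq_sum_net_outflow:
  "dirichlet G r \<phi> \<psi> = (\<Sum>v\<in>verts G. \<psi> v * net_outflow G (current G r \<phi>) v)"
  by (simp add: sum_mult_net_outflow dirichlet_def current_def mult.commute)

text \<open>Summation by parts against Kirchhoff's law leaves only the source and the sink. Thus the
  potential represents the voltage drop in the energy form, on which the later estimates
  rest.\<close>

lemma unit_current_potential_dirichlet:
  assumes "unit_current_potential G r a b \<phi>" "a \<in> verts G" "b \<in> verts G"
  shows "dirichlet G r \<phi> \<psi> = \<psi> a - \<psi> b"
proof -
  have "dirichlet G r \<phi> \<psi> =
      (\<Sum>v\<in>verts G. (if v = a then \<psi> v else 0) - (if v = b then \<psi> v else 0))"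
    unfolding dirichlet_eq_sum_net_outflow
    using assms(1) by (intro sum.cong) (auto simp: unit_current_potential_def)
  also have "\<dots> = \<psi> a - \<psi> b"
    using assms(2,3) by (simp add: sum_subtractf sum.delta')
  finally show ?thesis .
qed

text \<open>Pairing two potentials with each other gives either drop, by symmetry of the form; hence
  the description in \<open>eff_resistance\<close> is well defined.\<close>

lemma eff_resistance_eq:
  assumes \<phi>: "unit_current_potential G r a b \<phi>" and ab: "a \<in> verts G" "b \<in> verts G"
  shows "eff_resistance G r a b = \<phi> a - \<phi> b"
  unfolding eff_resistance_def
proof (rule the_equality)
  fix R assume "\<exists>\<phi>'. unit_current_potential G r a b \<phi>' \<and> R = \<phi>' a - \<phi>' b"
  then obtain \<phi>' where \<phi>': "unit_current_potential G r a b \<phi>'" "R = \<phi>' a - \<phi>' b" by blast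
  have "R = dirichlet G r \<phi> \<phi>'"
    using unit_current_potential_dirichlet[OF \<phi> ab] \<phi>'(2) by simp
  also have "\<dots> = dirichlet G r \<phi>' \<phi>" by (rule dirichlet_commute)
  also have "\<dots> = \<phi> a - \<phi> b"
    using unit_current_potential_dirichlet[OF \<phi>'(1) ab] by simp
  finally show "R = \<phi> a - \<phi> b" .
qed (use \<phi> in blast)

section \<open>Existence of the unit current potential\<close>

lemma connected_imp_eq:
  assumes conn: "Digraph_Component.connected G"
    and const: "\<forall>e\<in>arcs G. \<phi> (tail G e) = \<phi> (head G e)"
    and "a \<in> verts G" "b \<in> verts G"
  shows "\<phi> a = \<phi> b"
proof -
  have "(a, b) \<in> rtrancl_on (verts G) (parcs (mk_symmetric G))"
    using assms by (auto simp: Digraph_Component.connected_def strongly_connected_def reachable_def)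
  then show ?thesis
  proof (induction rule: rtrancl_on_induct)
    case (step x y)
    then show ?case using const by (auto simp: parcs_mk_symmetric)
  qed simp
qed

text \<open>
  Minimising over functions with values in \<open>[0, 1]\<close> is enough, since truncation does not increase
  the energy; this set is compact in the product topology.
\<close>

lemma dirichlet_minimiser:
  assumes r: "\<forall>e\<in>arcs G. 0 < r e" and ab: "a \<noteq> b"
  obtains \<phi> where "\<phi> a = 1" "\<phi> b = 0"
    "\<And>\<psi>. \<psi> a = 1 \<Longrightarrow> \<psi> b = 0 \<Longrightarrow> dirichlet G r \<phi> \<phi> \<le> dirichlet G r \<psi> \<psi>"
proof -
  define I where "I v = (if v = a then {1} else if v = b then {0} else {0..1::real})" for v
  have "compactin (product_topology (\<lambda>_. euclidean) UNIV) (PiE UNIV I)"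
    by (subst compactin_PiE) (auto simp: I_def)
  then have "compact (PiE UNIV I)"
    by (simp add: euclidean_product_topology)
  moreover have "(\<lambda>v. if v = a then 1 else 0) \<in> PiE UNIV I"
    using ab by (auto simp: I_def)
  then have "PiE UNIV I \<noteq> {}" by blast
  \<comment> \<open>Only the finitely many coordinates at ends of arcs enter the energy.\<close>
  moreover have "continuous_on (PiE UNIV I) (\<lambda>\<phi>. dirichlet G r \<phi> \<phi>)"
    unfolding dirichlet_def divide_inverse
    by (intro continuous_on_sum continuous_on_mult continuous_on_diff continuous_on_const
        continuous_on_subset[OF continuous_on_product_coordinates]) auto
  ultimately have "\<exists>\<phi>\<in>PiE UNIV I. \<forall>\<psi>\<in>PiE UNIV I. dirichlet G r \<phi> \<phi> \<le> dirichlet G r \<psi> \<psi>"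
    by (rule continuous_attains_inf)
  then obtain \<phi> where \<phi>: "\<phi> \<in> PiE UNIV I"
      "\<And>\<psi>. \<psi> \<in> PiE UNIV I \<Longrightarrow> dirichlet G r \<phi> \<phi> \<le> dirichlet G r \<psi> \<psi>"
    by blast
  have "dirichlet G r \<phi> \<phi> \<le> dirichlet G r \<psi> \<psi>" if \<psi>: "\<psi> a = 1" "\<psi> b = 0" for \<psi>
  proof -
    define \<psi>' where "\<psi>' v = max 0 (min 1 (\<psi> v))" for v
    have "\<psi>' \<in> PiE UNIV I" using \<psi> by (auto simp: I_def \<psi>'_def)
    then have "dirichlet G r \<phi> \<phi> \<le> dirichlet G r \<psi>' \<psi>'" by (rule \<phi>(2))
    also have "\<dots> \<le> dirichlet G r \<psi> \<psi>"
      unfolding dirichlet_def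
    proof (intro sum_mono divide_right_mono)
      fix e
      have "\<bar>\<psi>' (tail G e) - \<psi>' (head G e)\<bar> \<le> \<bar>\<psi> (tail G e) - \<psi> (head G e)\<bar>"
        by (auto simp: \<psi>'_def max_def min_def)
      then show "(\<psi>' (tail G e) - \<psi>' (head G e)) * (\<psi>' (tail G e) - \<psi>' (head G e))
          \<le> (\<psi> (tail G e) - \<psi> (head G e)) * (\<psi> (tail G e) - \<psi> (head G e))"
        by (simp add: abs_le_square_iff power2_eq_square)
    qed (use r in \<open>auto intro: less_imp_le\<close>)
    finally show ?thesis .
  qed
  moreover have "\<phi> a = 1" "\<phi> b = 0"
    using \<phi>(1) ab by (auto simp: I_def PiE_iff Pi_iff split: if_splits)
  ultimately show ?thesis using that by blast
qed

text \<open>The energy minimiser for boundary values 1 and 0 is orthogonal to all functions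
  vanishing at \<open>a\<close> and \<open>b\<close>, so its current is balanced elsewhere. Dividing
  it by its energy makes the current from \<open>a\<close> to \<open>b\<close> a unit
  current.\<close>

lemma unit_current_potential_exists:
  assumes conn: "Digraph_Component.connected G" and r: "\<forall>e\<in>arcs G. 0 < r e"
    and ab: "a \<in> verts G" "b \<in> verts G" "a \<noteq> b"
  obtains \<phi> where "unit_current_potential G r a b \<phi>"
proof -
  obtain \<phi> where \<phi>: "\<phi> a = 1" "\<phi> b = 0"
      "\<And>\<psi>. \<psi> a = 1 \<Longrightarrow> \<psi> b = 0 \<Longrightarrow> dirichlet G r \<phi> \<phi> \<le> dirichlet G r \<psi> \<psi>"
    using dirichlet_minimiser[OF r ab(3)] by blast
  have orth: "dirichlet G r \<phi> \<eta> = 0" if "\<eta> a = 0" "\<eta> b = 0" for \<eta>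
  proof (rule linear_coefficient_eq_0)
    fix t
    show "0 \<le> 2 * t * dirichlet G r \<phi> \<eta> + t\<^sup>2 * dirichlet G r \<eta> \<eta>"
      using \<phi>(3)[of "\<lambda>v. \<phi> v + t * \<eta> v"] \<phi>(1,2) that by (simp add: dirichlet_add_scaled)
  qed (rule dirichlet_nonneg[OF r])
  define E where "E = dirichlet G r \<phi> \<phi>"
  have "E \<noteq> 0"
  proof
    assume "E = 0"
    then have "\<forall>e\<in>arcs G. (\<phi> (tail G e) - \<phi> (head G e)) * (\<phi> (tail G e) - \<phi> (head G e)) / r e = 0"
      unfolding E_def dirichlet_def using r
      by (subst (asm) sum_nonneg_eq_0_iff) (auto intro: less_imp_le)
    then have "\<forall>e\<in>arcs G. \<phi> (tail G e) = \<phi> (head G e)"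
      using r by fastforce
    then have "\<phi> a = \<phi> b" by (rule connected_imp_eq[OF conn _ ab(1,2)])
    then show False using \<phi>(1,2) by simp
  qed
  have B: "dirichlet G r \<phi> \<psi> = (\<psi> a - \<psi> b) * E" for \<psi>
  proof -
    \<comment> \<open>Subtracting a constant and a multiple of \<open>\<phi>\<close> from
      \<open>\<psi>\<close> leaves a function vanishing at both ends; constants do not affect the
      form.\<close>
    have "dirichlet G r \<phi> (\<lambda>v. \<psi> v - \<psi> b - (\<psi> a - \<psi> b) * \<phi> v) = 0"
      using \<phi>(1,2) by (intro orth) auto
    moreover have "dirichlet G r \<phi> (\<lambda>v. \<psi> v - \<psi> b - (\<psi> a - \<psi> b) * \<phi> v) =
        dirichlet G r \<phi> \<psi> - (\<psi> a - \<psi> b) * E"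
      unfolding E_def dirichlet_def sum_distrib_left sum_subtractf[symmetric]
      by (intro sum.cong) (auto simp: diff_divide_distrib add_divide_distrib algebra_simps)
    ultimately show ?thesis by simp
  qed
  have "net_outflow G (current G r (\<lambda>v. \<phi> v / E)) v = (if v = a then 1 else 0) - (if v = b then 1 else 0)"
    if "v \<in> verts G" for v
  proof -
    \<comment> \<open>Pairing with the indicator of \<open>v\<close> reads off the net outflow at
      \<open>v\<close>.\<close>
    have "net_outflow G (current G r (\<lambda>v. \<phi> v / E)) v =
        dirichlet G r (\<lambda>v. \<phi> v / E) (\<lambda>u. if u = v then 1 else 0)"
      unfolding dirichlet_eq_sum_net_outflow using that by (simp add: mult_if_delta)
    also have "\<dots> = dirichlet G r \<phi> (\<lambda>u. if u = v then 1 else 0) / E"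
      unfolding dirichlet_def sum_divide_distrib
      by (intro sum.cong refl) (simp add: mult.commute flip: diff_divide_distrib)
    also have "\<dots> = (if v = a then 1 else 0) - (if v = b then 1 else 0)"
      using \<open>E \<noteq> 0\<close> by (auto simp: B)
    finally show ?thesis .
  qed
  then have "unit_current_potential G r a b (\<lambda>v. \<phi> v / E)"
    by (simp add: unit_current_potential_def)
  then show ?thesis by (rule that)
qed

section \<open>Variational bounds for the effective resistance\<close>

lemma eff_resistance_potential:
  assumes conn: "Digraph_Component.connected G" and r: "\<forall>e\<in>arcs G. 0 < r e"
    and ab: "a \<in> verts G" "b \<in> verts G" "a \<noteq> b"
  obtains \<phi> where "\<phi> a - \<phi> b = eff_resistance G r a b"
    "\<And>\<psi>. dirichlet G r \<phi> \<psi> = \<psi> a - \<psi> b"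
  using unit_current_potential_exists[OF assms] eff_resistance_eq[OF _ ab(1,2)]
    unit_current_potential_dirichlet[OF _ ab(1,2)] by metis

text \<open>Pairing the potential with itself shows that the resistance is its energy. Were it zero,
  the potential would be a null vector of a semidefinite form and pair to zero with everything,
  whereas it pairs to 1 with the indicator of \<open>a\<close>.\<close>

lemma eff_resistance_pos:
  assumes conn: "Digraph_Component.connected G" and r: "\<forall>e\<in>arcs G. 0 < r e"
    and ab: "a \<in> verts G" "b \<in> verts G" "a \<noteq> b"
  shows "0 < eff_resistance G r a b"
proof -
  obtain \<phi> where \<phi>: "\<phi> a - \<phi> b = eff_resistance G r a b"
      "\<And>\<psi>. dirichlet G r \<phi> \<psi> = \<psi> a - \<psi> b"
    using eff_resistance_potential[OF assms] by blast
  let ?\<psi> = "\<lambda>v. if v = a then 1 else 0 :: real"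
  have "0 \<le> eff_resistance G r a b"
    using dirichlet_nonneg[OF r, of \<phi>] \<phi> by simp
  moreover have "eff_resistance G r a b \<noteq> 0"
  proof
    assume "eff_resistance G r a b = 0"
    then have zero: "dirichlet G r \<phi> \<phi> = 0" using \<phi> by simp
    have "dirichlet G r \<phi> ?\<psi> = 0"
    proof (rule linear_coefficient_eq_0)
      fix t
      show "0 \<le> 2 * t * dirichlet G r \<phi> ?\<psi> + t\<^sup>2 * (dirichlet G r ?\<psi> ?\<psi>)"
        using dirichlet_nonneg[OF r, of "\<lambda>v. \<phi> v + t * ?\<psi> v"] zero
        by (simp only: dirichlet_add_scaled)
    qed (rule dirichlet_nonneg[OF r])
    then show False using \<phi>(2)[of ?\<psi>] ab(3) by simp
  qed
  ultimately show ?thesis by simp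
qed

text \<open>This is Cauchy-Schwarz for the energy form, applied to \<open>\<psi>\<close> and the
  unit current potential, whose energy is the resistance.\<close>

theorem Dirichlet_principle:
  assumes conn: "Digraph_Component.connected G" and r: "\<forall>e\<in>arcs G. 0 < r e"
    and ab: "a \<in> verts G" "b \<in> verts G" "a \<noteq> b"
  shows "(\<psi> a - \<psi> b)\<^sup>2 \<le> eff_resistance G r a b * dirichlet G r \<psi> \<psi>"
proof -
  obtain \<phi> where \<phi>: "\<phi> a - \<phi> b = eff_resistance G r a b"
      "\<And>\<psi>. dirichlet G r \<phi> \<psi> = \<psi> a - \<psi> b"
    using eff_resistance_potential[OF assms] by blast
  define R where "R = eff_resistance G r a b"
  \<comment> \<open>The value that minimises the energy of
    \<open>\<psi> + t * \<phi>\<close>.\<close>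
  define t where "t = - (\<psi> a - \<psi> b) / R"
  have R: "R > 0" unfolding R_def by (rule eff_resistance_pos[OF assms])
  have "0 \<le> dirichlet G r \<psi> \<psi> + 2 * t * dirichlet G r \<psi> \<phi> + t\<^sup>2 * dirichlet G r \<phi> \<phi>"
    unfolding dirichlet_add_scaled[symmetric] by (rule dirichlet_nonneg[OF r])
  also have "\<dots> = dirichlet G r \<psi> \<psi> + 2 * t * (\<psi> a - \<psi> b) + t\<^sup>2 * R"
    using \<phi> by (simp add: dirichlet_commute[of G r \<psi> \<phi>] R_def)
  also have "\<dots> = dirichlet G r \<psi> \<psi> - (\<psi> a - \<psi> b)\<^sup>2 / R"
    using R by (simp add: t_def power2_eq_square field_simps)
  finally show ?thesis
    using R by (simp add: R_def[symmetric] pos_divide_le_eq mult.commute)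
qed

text \<open>Scaling the potential together with the resistances leaves every current
  unchanged.\<close>

lemma eff_resistance_scale:
  assumes conn: "Digraph_Component.connected G" and r: "\<forall>e\<in>arcs G. 0 < r e" and c: "c > 0"
    and ab: "a \<in> verts G" "b \<in> verts G" "a \<noteq> b"
  shows "eff_resistance G (\<lambda>e. c * r e) a b = c * eff_resistance G r a b"
proof -
  obtain \<phi> where \<phi>: "unit_current_potential G r a b \<phi>"
    using unit_current_potential_exists[OF conn r ab] .
  have "current G (\<lambda>e. c * r e) (\<lambda>v. c * \<phi> v) = current G r \<phi>"
    using c by (auto simp: current_def fun_eq_iff simp flip: right_diff_distrib)
  then have "unit_current_potential G (\<lambda>e. c * r e) a b (\<lambda>v. c * \<phi> v)"
    using \<phi> by (simp add: unit_current_potential_def)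
  then have "eff_resistance G (\<lambda>e. c * r e) a b = c * \<phi> a - c * \<phi> b"
    using ab by (intro eff_resistance_eq)
  then show ?thesis
    using eff_resistance_eq[OF \<phi> ab(1,2)] by (simp add: right_diff_distrib)
qed

section \<open>Cuts\<close>

text \<open>The indicator of \<open>X\<close> is the test function in Dirichlet's principle: its
  drop is 1, and only crossing arcs contribute energy, each at most \<open>1 / s\<close>.\<close>

lemma eff_resistance_cut_bound:
  assumes conn: "Digraph_Component.connected G" and r: "\<forall>e\<in>arcs G. 0 < r e"
    and X: "a \<in> verts G" "b \<in> verts G" "a \<in> X" "b \<notin> X"
    and s: "s > 0" "\<And>e. \<lbrakk>e \<in> arcs G; (tail G e \<in> X) \<noteq> (head G e \<in> X)\<rbrakk> \<Longrightarrow> s \<le> r e"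
  shows "s \<le> real (card (arcs G)) * eff_resistance G r a b"
proof -
  let ?\<psi> = "indicat_real X"
  have ab: "a \<noteq> b" using X by blast
  have "dirichlet G r ?\<psi> ?\<psi> \<le> (\<Sum>e\<in>arcs G. 1 / s)"
    unfolding dirichlet_def
  proof (rule sum_mono)
    fix e assume e: "e \<in> arcs G"
    show "(?\<psi> (tail G e) - ?\<psi> (head G e)) * (?\<psi> (tail G e) - ?\<psi> (head G e)) / r e \<le> 1 / s"
    proof (cases "(tail G e \<in> X) = (head G e \<in> X)")
      case False
      then have "1 / r e \<le> 1 / s"
        using s e r by (intro divide_left_mono) auto
      then show ?thesis using False by (auto simp: indicator_def)
    qed (use s in \<open>auto simp: indicator_def\<close>)
  qed
  then have E: "dirichlet G r ?\<psi> ?\<psi> \<le> real (card (arcs G)) / s" by simp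
  have "1 \<le> eff_resistance G r a b * dirichlet G r ?\<psi> ?\<psi>"
    using Dirichlet_principle[OF conn r X(1,2) ab, of ?\<psi>] X by simp
  also have "\<dots> \<le> eff_resistance G r a b * (real (card (arcs G)) / s)"
    using E eff_resistance_pos[OF conn r X(1,2) ab] by (intro mult_left_mono) auto
  finally show ?thesis using s by (simp add: field_simps)
qed

text \<open>The potential \<open>\<phi>\<close> for \<open>r\<close> serves as test function in the
  network with resistances \<open>r'\<close>. Its energy there is strictly below \<open>R\<close>,
  and Dirichlet's principle turns this into \<open>R\<^sup>2 < R' * R\<close>.\<close>

lemma eff_resistance_strict_mono:
  assumes conn: "Digraph_Component.connected G" and r: "\<forall>e\<in>arcs G. 0 < r e"
    and le: "\<forall>e\<in>arcs G. r e \<le> r' e"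
    and X: "a \<in> verts G" "b \<in> verts G" "a \<in> X" "b \<notin> X"
    and less: "\<And>e. \<lbrakk>e \<in> arcs G; (tail G e \<in> X) \<noteq> (head G e \<in> X)\<rbrakk> \<Longrightarrow> r e < r' e"
  shows "eff_resistance G r a b < eff_resistance G r' a b"
proof -
  have ab: "a \<noteq> b" using X by blast
  have r': "\<forall>e\<in>arcs G. 0 < r' e" using r le by (meson order_less_le_trans)
  define R where "R = eff_resistance G r a b"
  define R' where "R' = eff_resistance G r' a b"
  have R: "R > 0" unfolding R_def by (rule eff_resistance_pos[OF conn r X(1,2) ab])
  have R': "R' > 0" unfolding R'_def by (rule eff_resistance_pos[OF conn r' X(1,2) ab])
  obtain \<phi> where \<phi>: "\<phi> a - \<phi> b = R" "\<And>\<psi>. dirichlet G r \<phi> \<psi> = \<psi> a - \<psi> b"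
    using eff_resistance_potential[OF conn r X(1,2) ab] unfolding R_def by blast
  \<comment> \<open>This pairing is the net current through the cut, which equals 1; hence some
    crossing arc has a nonzero drop.\<close>
  have "dirichlet G r \<phi> (indicat_real X) \<noteq> 0" using \<phi>(2) X by simp
  then obtain e where e: "e \<in> arcs G" and
    "(\<phi> (tail G e) - \<phi> (head G e)) * (indicat_real X (tail G e) - indicat_real X (head G e)) / r e \<noteq> 0"
    unfolding dirichlet_def by (meson sum.neutral)
  then have drop: "\<phi> (tail G e) \<noteq> \<phi> (head G e)" "(tail G e \<in> X) \<noteq> (head G e \<in> X)"
    by (auto simp: indicator_def)
  have "dirichlet G r' \<phi> \<phi> < dirichlet G r \<phi> \<phi>"
    unfolding dirichlet_def
  proof (rule sum_strict_mono_ex1)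
    show "\<forall>e\<in>arcs G. (\<phi> (tail G e) - \<phi> (head G e)) * (\<phi> (tail G e) - \<phi> (head G e)) / r' e
        \<le> (\<phi> (tail G e) - \<phi> (head G e)) * (\<phi> (tail G e) - \<phi> (head G e)) / r e"
      using r r' le by (intro ballI divide_left_mono) auto
    have "(\<phi> (tail G e) - \<phi> (head G e)) * (\<phi> (tail G e) - \<phi> (head G e)) / r' e
        < (\<phi> (tail G e) - \<phi> (head G e)) * (\<phi> (tail G e) - \<phi> (head G e)) / r e"
      using r r' e drop less[OF e drop(2)]
      by (intro divide_strict_left_mono) (auto simp: zero_less_mult_iff)
    then show "\<exists>e\<in>arcs G. (\<phi> (tail G e) - \<phi> (head G e)) * (\<phi> (tail G e) - \<phi> (head G e)) / r' e
        < (\<phi> (tail G e) - \<phi> (head G e)) * (\<phi> (tail G e) - \<phi> (head G e)) / r e"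
      using e by blast
  qed simp
  then have "dirichlet G r' \<phi> \<phi> < R" using \<phi> by simp
  then have "R' * dirichlet G r' \<phi> \<phi> < R' * R" using R' by simp
  moreover have "R\<^sup>2 \<le> R' * dirichlet G r' \<phi> \<phi>"
    using Dirichlet_principle[OF conn r' X(1,2) ab, of \<phi>] \<phi>(1) by (simp add: R'_def)
  ultimately have "R * R < R' * R" by (simp add: power2_eq_square)
  then show ?thesis using R by (simp add: R_def R'_def)
qed

end

text \<open>Delete \<open>D\<close> and let \<open>X\<close> be the complement of the component of
  \<open>b\<close> in what remains; an arc leaving that component must have been deleted.\<close>

lemma separating_cut:
  assumes G: "rule_graph G" and ab: "a \<in> verts G" "b \<in> verts G"
    and sep: "\<And>p. simple_upath G a p b \<Longrightarrow> \<exists>e\<in>D. lies_on G e p" and D: "D \<subseteq> arcs G"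
  obtains X where "a \<in> X" "b \<notin> X"
    "\<And>e. \<lbrakk>e \<in> arcs G; (tail G e \<in> X) \<noteq> (head G e \<in> X)\<rbrakk> \<Longrightarrow> e \<in> D"
proof -
  interpret fin_digraph G using G by (simp add: rule_graph_def)
  have inj: "inj_on (\<lambda>e. {tail G e, head G e}) (arcs G)"
    using G by (simp add: rule_graph_def underlying_simple_def)
  define H where "H = with_proj (mk_symmetric (G\<lparr>arcs := arcs G - D\<rparr>))"
  have verts_H: "verts H = verts G" by (simp add: H_def)
  have arcs_H: "(u, v) \<in> arcs_ends H \<longleftrightarrow>
      (\<exists>e\<in>arcs G - D. (u, v) = (tail G e, head G e) \<or> (u, v) = (head G e, tail G e))" for u v
    by (auto simp: H_def parcs_mk_symmetric)
  \<comment> \<open>Walks instead of simple paths, so that prepending a neighbour needs no check for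
    repetition; a walk from \<open>a\<close> is shortened to a simple path afterwards.\<close>
  define Y where "Y = {v. \<exists>p. vwalk p H \<and> hd p = v \<and> last p = b}"
  have Y_step: "u \<in> Y" if v: "v \<in> Y" and "u \<in> verts G" "(u, v) \<in> arcs_ends H" for u v
  proof -
    from v have "\<exists>p. vwalk p H \<and> hd p = v \<and> last p = b" by (simp add: Y_def)
    then obtain p where p: "vwalk p H" "hd p = v" "last p = b" by (elim exE conjE)
    have "vwalk (u # p) H"
      using that p by (intro vwalk_consI) (simp_all add: verts_H)
    moreover have "last (u # p) = b" using p by (auto simp: vwalk_def)
    ultimately show ?thesis unfolding Y_def by (intro CollectI exI[of _ "u # p"]) simp
  qed
  have "b \<in> Y"
    using ab(2) by (auto simp: Y_def vwalk_def verts_H intro!: exI[of _ "[b]"])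
  moreover have "a \<notin> Y"
  proof
    assume "a \<in> Y"
    then have "\<exists>q. vwalk q H \<and> hd q = a \<and> last q = b" by (simp add: Y_def)
    then obtain q where q: "vwalk q H" "hd q = a" "last q = b" by (elim exE conjE)
    define p where "p = vwalk_to_vpath q"
    have p: "vpath p H" "hd p = a" "last p = b"
      unfolding p_def vwalk_to_vpath_hd vwalk_to_vpath_last
      by (rule vwalk_to_vpath_vpath[OF q(1)], rule q(2), rule q(3))
    have "simple_upath G a p b"
      using p by (auto simp: simple_upath_def vpath_def vwalk_def H_def parcs_mk_symmetric)
    then obtain e where e: "e \<in> D" "lies_on G e p" using sep by blast
    have sub: "set (vwalk_arcs p) \<subseteq> arcs_ends H" using p(1) by (auto simp: vpath_def vwalk_def)
    obtain u v where uv: "(u, v) \<in> set (vwalk_arcs p)" "{tail G e, head G e} = {u, v}"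
      using e(2) unfolding lies_on_def by (elim disjE) (simp_all add: insert_commute)
    have "(u, v) \<in> arcs_ends H" by (rule subsetD[OF sub uv(1)])
    then obtain e' where e': "e' \<in> arcs G - D"
        "(u, v) = (tail G e', head G e') \<or> (u, v) = (head G e', tail G e')"
      unfolding arcs_H by (elim bexE)
    from e'(2) have "{u, v} = {tail G e', head G e'}" by (elim disjE) (simp_all add: insert_commute)
    \<comment> \<open>Simplicity of the underlying graph enters here: \<open>e\<close> in
      \<open>D\<close> and \<open>e'\<close> outside \<open>D\<close> join the same two vertices, so
      they would be the same arc.\<close>
    then have "e = e'" using inj_onD[OF inj, of e e'] uv(2) e(1) e'(1) D by (simp add: subset_iff)
    then show False using e(1) e'(1) by simp
  qed
  moreover have "e \<in> D" if "e \<in> arcs G" "(tail G e \<in> - Y) \<noteq> (head G e \<in> - Y)" for e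
  proof (rule ccontr)
    assume "e \<notin> D"
    then have "(tail G e, head G e) \<in> arcs_ends H" "(head G e, tail G e) \<in> arcs_ends H"
      using that(1) unfolding arcs_H by blast+
    then show False
      using that Y_step tail_in_verts head_in_verts by blast
  qed
  ultimately show ?thesis using that[of "- Y"] by blast
qed

section \<open>The resistance map\<close>

locale distance_positive_eigs =
  fixes S :: "('v, 'e, 'k::finite) eigs"
  assumes eigs: "is_eigs S" and distance_positive: "distance_positive S"
begin

lemma rule_graph: "rule_graph (rule S i)"
  and plant_in_verts: "plant S i s \<in> verts (rule S i)"
  and plants_distinct: "plant S i True \<noteq> plant S i False"
  using eigs by (auto simp: is_eigs_def)

lemma rule_fin_digraph: "fin_digraph (rule S i)"
  and rule_connected: "Digraph_Component.connected (rule S i)"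
  using rule_graph by (auto simp: rule_graph_def)

text \<open>By distance-positivity the arcs of colour \<open>j\<close> meet every simple path
  between the planting vertices, as \<open>separating_cut\<close> demands.\<close>

lemma monochromatic_cut:
  obtains X where "plant S i True \<in> X" "plant S i False \<notin> X"
    "\<And>e. \<lbrakk>e \<in> arcs (rule S i); (tail (rule S i) e \<in> X) \<noteq> (head (rule S i) e \<in> X)\<rbrakk>
      \<Longrightarrow> rule_colour S i e = j"
proof -
  have "\<exists>e\<in>{e \<in> arcs (rule S i). rule_colour S i e = j}. lies_on (rule S i) e p"
    if "simple_upath (rule S i) (plant S i True) p (plant S i False)" for p
    using distance_positive that unfolding distance_positive_def by blast
  from separating_cut[OF rule_graph plant_in_verts plant_in_verts this]
  show ?thesis using that by (auto simp: subset_iff)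
qed

lemma resistance_map_scale:
  assumes "c > 0" "\<forall>i. x $ i > 0"
  shows "resistance_map S (c *\<^sub>R x) = c *\<^sub>R resistance_map S x"
  using assms
  by (auto simp: vec_eq_iff resistance_map_def plant_in_verts plants_distinct rule_connected
      intro!: fin_digraph.eff_resistance_scale[OF rule_fin_digraph])

lemma resistance_map_strict_mono:
  assumes x: "\<forall>i. x $ i > 0" and le: "\<forall>i. x $ i \<le> y $ i" and "x \<noteq> y"
  shows "resistance_map S x $ i < resistance_map S y $ i"
proof -
  \<comment> \<open>For the colour \<open>j\<close> of an increased entry, every arc across a
    \<open>j\<close>-coloured cut gets a strictly larger resistance, whichever rule graph
    \<open>i\<close> is considered.\<close>
  obtain j where j: "x $ j < y $ j"
    using le \<open>x \<noteq> y\<close> by (metis order_le_imp_less_or_eq vec_eq_iff)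
  obtain X where X: "plant S i True \<in> X" "plant S i False \<notin> X"
    "\<And>e. \<lbrakk>e \<in> arcs (rule S i); (tail (rule S i) e \<in> X) \<noteq> (head (rule S i) e \<in> X)\<rbrakk>
      \<Longrightarrow> rule_colour S i e = j"
    using monochromatic_cut by blast
  show ?thesis
    unfolding resistance_map_def vec_lambda_beta
    by (rule fin_digraph.eff_resistance_strict_mono[OF rule_fin_digraph rule_connected, where X = X])
      (use x le j X plant_in_verts in auto)
qed

text \<open>All arcs across a cut of colour \<open>j\<close> have resistance exactly
  \<open>x $ j\<close>.\<close>

lemma resistance_map_lower_bound:
  assumes x: "\<forall>i. x $ i > 0"
  shows "x $ j \<le> real (card (arcs (rule S i))) * resistance_map S x $ i"
proof -
  obtain X where X: "plant S i True \<in> X" "plant S i False \<notin> X"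
    "\<And>e. \<lbrakk>e \<in> arcs (rule S i); (tail (rule S i) e \<in> X) \<noteq> (head (rule S i) e \<in> X)\<rbrakk>
      \<Longrightarrow> rule_colour S i e = j"
    using monochromatic_cut by blast
  show ?thesis
    unfolding resistance_map_def vec_lambda_beta
    by (rule fin_digraph.eff_resistance_cut_bound[OF rule_fin_digraph rule_connected, where X = X])
      (use x X plant_in_verts in auto)
qed

lemma resistance_map_nonneg:
  assumes x: "\<forall>i. x $ i > 0"
  shows "0 \<le> resistance_map S x $ i"
  unfolding resistance_map_def vec_lambda_beta
  by (rule less_imp_le, rule fin_digraph.eff_resistance_pos[OF rule_fin_digraph rule_connected])
    (use x plant_in_verts plants_distinct in auto)

text \<open>One constant has to serve all rules: the sum dominates each arc count, and the summand 1
  makes its positivity immediate.\<close>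

sublocale strict_homogeneous_map "resistance_map S" "1 + (\<Sum>i\<in>UNIV. real (card (arcs (rule S i))))"
proof
  fix x :: "real ^ 'k" and i j
  assume x: "\<forall>i. x $ i > 0"
  have "real (card (arcs (rule S i))) \<le> (\<Sum>i\<in>UNIV. real (card (arcs (rule S i))))"
    by (intro member_le_sum) auto
  then have "real (card (arcs (rule S i))) * resistance_map S x $ i \<le>
      (1 + (\<Sum>i\<in>UNIV. real (card (arcs (rule S i))))) * resistance_map S x $ i"
    using resistance_map_nonneg[OF x] by (intro mult_right_mono) auto
  then show "x $ j \<le> (1 + (\<Sum>i\<in>UNIV. real (card (arcs (rule S i))))) * resistance_map S x $ i"
    using resistance_map_lower_bound[OF x, of j i] by linarith
qed (auto simp: resistance_map_scale resistance_map_strict_mono add_pos_nonneg sum_nonneg)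

end

theorem lemma2p6:
  fixes S :: "('v, 'e, 'k::finite) eigs"
  assumes "is_eigs S"
    and "standing_assumptions S"
  shows "\<exists>\<rho> v. \<rho> > 0 \<and> (\<forall>i. v $ i > 0) \<and> resistance_map S v = \<rho> *\<^sub>R v \<and>
           (\<forall>\<rho>' w. \<rho>' > 0 \<and> (\<forall>i. w $ i > 0) \<and> resistance_map S w = \<rho>' *\<^sub>R w \<longrightarrow>
              \<rho>' = \<rho> \<and> (\<exists>c>0. w = c *\<^sub>R v))"
proof -
  interpret distance_positive_eigs S
    using assms by unfold_locales (auto simp: standing_assumptions_def)
  show ?thesis
    using eigenvector_exists eigenvector_unique by meson
qed

end
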